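(* Let $0 < c < \frac{1}{2}$ be fixed, and let $t$ be a large integer. There exists a graph $G$ of treewidth $t$ and clique number $\lfloor (1 - c)t \rfloor$ satisfying \[ \chi_f(G) \geq t + 1 + \frac{1}{2}\log (1-2c) - o(1).\] That is: for every fixed $c \in (0,\frac12)$ and every $\varepsilon > 0$ there is $t_0$ such that for every integer $t \geq t_0$ there exists a graph $G$ of treewidth $t$ and clique number $\lfloor (1-c)t \rfloor$ with $\chi_f(G) \geq t + 1 + \frac{1}{2}\log(1-2c) - \varepsilon$.
   Context: Graphs are finite and simple. $\log$ is the natural logarithm, and $o(1)$ denotes a quantity tending to $0$ as $t \to \infty$ with $c$ fixed. The clique number of $G$ is the number of vertices in a largest clique of $G$. A $t$-tree is a graph obtained by starting with a $t$-clique and then iteratively adding vertices $v$ such that, at the time $v$ is added, its neighborhood $N(v)$ induces a $K_t$. A partial $t$-tree is a subgraph of a $t$-tree. The treewidth of $G$ is the minimum $t$ for which $G$ is a partial $t$-tree (this agrees with the usual definition of treewidth). A fractional coloring of $G$ assigns to each vertex $v \in V(G)$ a set $\phi(v) \subseteq \mathbb{R}$ of Lebesgue measure $\mu(\phi(v)) = 1$ so that $\phi(u) \cap \phi(v) = \emptyset$ for each edge $uv \in E(G)$. The fractional chromatic number $\chi_f(G)$ is the infimum of $\mu\left(\bigcup_{v \in V(G)} \phi(v)\right)$ over all fractional colorings $\phi$ of $G$. Equivalently, $\chi_f(G) = \inf_{b \geq 1} \chi_b(G)/b$, where $\chi_b(G)$ is the least $k$ such that one can assign to each vertex a $b$-element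 subset of $\{1,\dots,k\}$ with adjacent vertices receiving disjoint subsets. *)

theory Defs
  imports "HOL-Analysis.Analysis"
begin

(* Vertices are natural numbers. This loses no finite graph up to isomorphism, and it leaves
   enough fresh vertices for a finite graph to be a literal subgraph of a t-tree. *)
record graph =
  verts :: "nat set"
  edges :: "nat set set"

definition simple_graph :: "graph \<Rightarrow> bool" where
  "simple_graph G \<longleftrightarrow> finite (verts G) \<and> (\<forall>e\<in>edges G. e \<subseteq> verts G \<and> card e = 2)"

definition subgraph :: "graph \<Rightarrow> graph \<Rightarrow> bool" where
  "subgraph H G \<longleftrightarrow>
     simple_graph H \<and> simple_graph G \<and> verts H \<subseteq> verts G \<and> edges H \<subseteq> edges G"

definition clique :: "graph \<Rightarrow> nat set \<Rightarrow> bool" where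
  "clique G K \<longleftrightarrow> K \<subseteq> verts G \<and> (\<forall>u\<in>K. \<forall>v\<in>K. u \<noteq> v \<longrightarrow> {u, v} \<in> edges G)"

definition clique_number :: "graph \<Rightarrow> nat" where
  "clique_number G = Max {card K | K. clique G K}"

definition complete_graph :: "nat set \<Rightarrow> graph" where
  "complete_graph S = \<lparr>verts = S, edges = {e. e \<subseteq> S \<and> card e = 2}\<rparr>"

definition add_vertex :: "graph \<Rightarrow> nat \<Rightarrow> nat set \<Rightarrow> graph" where
  "add_vertex G v N = \<lparr>verts = insert v (verts G), edges = edges G \<union> {{u, v} | u. u \<in> N}\<rparr>"

inductive t_tree :: "nat \<Rightarrow> graph \<Rightarrow> bool" for t :: nat where
  start: "finite S \<Longrightarrow> card S = t \<Longrightarrow> t_tree t (complete_graph S)"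
| add: "t_tree t G \<Longrightarrow> v \<notin> verts G \<Longrightarrow> clique G N \<Longrightarrow> card N = t \<Longrightarrow> t_tree t (add_vertex G v N)"

definition partial_t_tree :: "nat \<Rightarrow> graph \<Rightarrow> bool" where
  "partial_t_tree t G \<longleftrightarrow> (\<exists>H. t_tree t H \<and> subgraph G H)"

(* The minimum exists for every finite simple graph: take t to be the number of vertices. *)
definition treewidth :: "graph \<Rightarrow> nat" where
  "treewidth G = (LEAST t. partial_t_tree t G)"

definition fractional_coloring :: "graph \<Rightarrow> (nat \<Rightarrow> real set) \<Rightarrow> bool" where
  "fractional_coloring G \<phi> \<longleftrightarrow>
     (\<forall>v\<in>verts G. \<phi> v \<in> lmeasurable \<and> measure lebesgue (\<phi> v) = 1) \<and>
     (\<forall>u v. {u, v} \<in> edges G \<longrightarrow> \<phi> u \<inter> \<phi> v = {})"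

(* For a finite simple graph the infimum is over a nonempty set of nonnegative reals, so the
   real-valued Inf is the true infimum. *)
definition fractional_chromatic_number :: "graph \<Rightarrow> real" where
  "fractional_chromatic_number G =
     Inf {measure lebesgue (\<Union>v\<in>verts G. \<phi> v) | \<phi>. fractional_coloring G \<phi>}"

end

theory Submission imports Defs "HOL-Real_Asymp.Real_Asymp" begin

text \<open>
  Let w be the floor of (1 - c) t and p = t + 1 - w. If a graph contains p disjoint pairs of
  non-adjacent vertices and t + 1 - 2 p further vertices such that all other pairs of vertices are
  adjacent, then its t + 1 vertices use colors of measure at least t + 1 minus the total overlap
  inside the p pairs, while its cliques have at most w vertices. The graph is obtained by
  repeatedly adding, to every t-clique of a host t-tree and every admissible subset S of it, a new
  vertex adjacent exactly to S, so that for each coloring one can search for pairs with small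
  overlap inside it, one move at a time.

  Suppose that i pairs have been found. A vertex not adjacent to a clique V overlaps some vertex
  of V in measure at most 1 / |V|; this crude choice yields, in the neighborhood of the i pairs, a
  set K of t - 2 i - r vertices with bounded cliques whose union of colors is smaller than |K| by
  only O(1). Choosing a clique L of r vertices beforehand, with no edges between L and K, the total
  overlap between L and K is at most r + O(1), so some pair overlaps in at most
  (1 + O(1 / r)) / (t - 2 i - r). Summing over i < p gives (1 + O(1 / r)) times
  -1/2 log (1 - 2 c) in the limit, and r is a large constant.
\<close>

section \<open>Graphs hosted by a t-tree\<close>

definition induced_subgraph :: "graph \<Rightarrow> graph \<Rightarrow> bool" where
  "induced_subgraph G G' \<longleftrightarrow> verts G \<subseteq> verts G' \<and>
     (\<forall>u\<in>verts G. \<forall>v\<in>verts G. {u, v} \<in> edges G' \<longleftrightarrow> {u, v} \<in> edges G)"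

definition cliques_le :: "graph \<Rightarrow> nat set \<Rightarrow> nat \<Rightarrow> bool" where
  "cliques_le G S q \<longleftrightarrow> (\<forall>C\<subseteq>S. clique G C \<longrightarrow> card C \<le> q)"

text \<open>The host \<open>H\<close> is carried along because new vertices may only be attached
  inside its \<open>t\<close>-cliques, which need not be cliques of \<open>G\<close>. Equal vertex
  sets make a vertex fresh for both graphs at once.\<close>

definition hosted :: "nat \<Rightarrow> nat \<Rightarrow> graph \<Rightarrow> graph \<Rightarrow> bool" where
  "hosted t w G H \<longleftrightarrow> t_tree t H \<and> verts G = verts H \<and> simple_graph G \<and> edges G \<subseteq> edges H \<and>
     cliques_le G (verts G) w"

lemma induced_subgraph_refl: "induced_subgraph G G"
  by (simp add: induced_subgraph_def)

lemma induced_subgraph_trans: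
  "induced_subgraph G G' \<Longrightarrow> induced_subgraph G' G'' \<Longrightarrow> induced_subgraph G G''"
  unfolding induced_subgraph_def by blast

lemma clique_induced_subgraph:
  assumes "induced_subgraph G G'" "C \<subseteq> verts G"
  shows "clique G' C \<longleftrightarrow> clique G C"
  using assms unfolding induced_subgraph_def clique_def by blast

lemma cliques_le_induced_subgraph:
  assumes "induced_subgraph G G'" "S \<subseteq> verts G"
  shows "cliques_le G' S q \<longleftrightarrow> cliques_le G S q"
  using clique_induced_subgraph[OF assms(1)] assms(2) unfolding cliques_le_def by blast

lemma clique_subset: "clique G C \<Longrightarrow> D \<subseteq> C \<Longrightarrow> clique G D"
  unfolding clique_def by blast

lemma cliques_le_Un:
  assumes "cliques_le G S a" "cliques_le G T b"
  shows "cliques_le G (S \<union> T) (a + b)"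
  unfolding cliques_le_def
proof (intro allI impI)
  fix C assume C: "C \<subseteq> S \<union> T" "clique G C"
  then have "card (C \<inter> S) \<le> a" "card (C \<inter> T) \<le> b"
    using assms clique_subset[OF C(2)] unfolding cliques_le_def by auto
  moreover have "C = (C \<inter> S) \<union> (C \<inter> T)" using C by blast
  then have "card C \<le> card (C \<inter> S) + card (C \<inter> T)" by (metis card_Un_le)
  ultimately show "card C \<le> a + b" by linarith
qed

lemma cliques_le_card: "finite S \<Longrightarrow> cliques_le G S (card S)"
  unfolding cliques_le_def by (simp add: card_mono)

lemma cliques_le_empty: "cliques_le G {} 0"
  unfolding cliques_le_def by auto

lemma cliques_le_mono: "cliques_le G S q \<Longrightarrow> q \<le> q' \<Longrightarrow> cliques_le G S q'"
  unfolding cliques_le_def by (blast intro: order_trans)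

lemma cliques_le_independent:
  assumes "finite I" "\<And>u v. u \<in> I \<Longrightarrow> v \<in> I \<Longrightarrow> u \<noteq> v \<Longrightarrow> {u, v} \<notin> edges G"
  shows "cliques_le G I 1"
  unfolding cliques_le_def
proof (intro allI impI)
  fix C assume C: "C \<subseteq> I" "clique G C"
  have "finite C" using C assms(1) finite_subset by blast
  then have "card C \<le> Suc 0 \<longleftrightarrow> (\<forall>a\<in>C. \<forall>b\<in>C. a = b)" by (simp add: card_le_Suc0_iff_eq)
  moreover have "\<forall>a\<in>C. \<forall>b\<in>C. a = b"
  proof (intro ballI, rule ccontr)
    fix a b assume ab: "a \<in> C" "b \<in> C" "a \<noteq> b"
    then have "{a, b} \<in> edges G" using C(2) by (simp add: clique_def)
    then show False using assms(2) ab C(1) by blast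
  qed
  ultimately show "card C \<le> 1" by simp
qed

lemma simple_graph_edge:
  assumes "simple_graph G" "{u, v} \<in> edges G"
  shows "u \<in> verts G" "v \<in> verts G" "u \<noteq> v"
  using assms unfolding simple_graph_def by force+

section \<open>Adding vertices to a graph and its host\<close>

lemma simple_graph_add_vertex:
  assumes "simple_graph G" "v \<notin> verts G" "N \<subseteq> verts G"
  shows "simple_graph (add_vertex G v N)"
proof -
  have "card {u, v} = 2" if "u \<in> N" for u
  proof -
    have "u \<noteq> v" using that assms by auto
    then show ?thesis by simp
  qed
  then show ?thesis
    using assms unfolding simple_graph_def add_vertex_def by auto
qed

lemma edge_add_vertex:
  assumes "simple_graph G" "v \<notin> verts G" "u \<in> verts G"
  shows "{u, v} \<in> edges (add_vertex G v N) \<longleftrightarrow> u \<in> N"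
proof -
  have "{u, v} \<notin> edges G" using simple_graph_edge[OF assms(1)] assms by blast
  moreover have "{u, v} = {u', v} \<longleftrightarrow> u = u'" for u' by (auto simp: doubleton_eq_iff)
  ultimately show ?thesis unfolding add_vertex_def by auto
qed

lemma induced_subgraph_add_vertex:
  assumes "v \<notin> verts G"
  shows "induced_subgraph G (add_vertex G v N)"
  using assms unfolding induced_subgraph_def add_vertex_def by (auto simp: doubleton_eq_iff)

text \<open>A clique through \<open>v\<close> is \<open>v\<close> together with a clique inside
  \<open>S\<close>, so it has at most \<open>(w - 1) + 1\<close> vertices; \<open>0 < w\<close>
  keeps the subtraction exact.\<close>

lemma cliques_le_add_vertex:
  assumes G: "simple_graph G" "v \<notin> verts G" "S \<subseteq> verts G"
    and w: "cliques_le G (verts G) w" "cliques_le G S (w - 1)" "0 < w"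
  shows "cliques_le (add_vertex G v S) (verts (add_vertex G v S)) w"
  unfolding cliques_le_def
proof (intro allI impI)
  let ?G = "add_vertex G v S"
  fix C assume C: "C \<subseteq> verts ?G" "clique ?G C"
  have ind: "induced_subgraph G ?G" by (rule induced_subgraph_add_vertex[OF G(2)])
  have sub: "C - {v} \<subseteq> verts G" using C(1) by (auto simp: add_vertex_def)
  have cl: "clique G (C - {v})"
    using clique_induced_subgraph[OF ind sub] clique_subset[OF C(2)] by blast
  show "card C \<le> w"
  proof (cases "v \<in> C")
    case True
    have "C - {v} \<subseteq> S"
    proof
      fix u assume u: "u \<in> C - {v}"
      then have "{u, v} \<in> edges ?G" using C(2) True unfolding clique_def by blast
      then show "u \<in> S" using edge_add_vertex[OF G(1,2)] u sub by blast
    qed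
    then have "card (C - {v}) \<le> w - 1" using w(2) cl unfolding cliques_le_def by blast
    then show ?thesis using True w(3) by simp
  next
    case False
    then show ?thesis using w(1) cl sub unfolding cliques_le_def by simp
  qed
qed

lemma simple_graph_complete_graph: "finite S \<Longrightarrow> simple_graph (complete_graph S)"
  unfolding simple_graph_def complete_graph_def by auto

lemma simple_graph_t_tree: "t_tree t H \<Longrightarrow> simple_graph H"
  by (induction rule: t_tree.induct)
    (auto intro: simple_graph_complete_graph simple_graph_add_vertex simp: clique_def)

text \<open>The host joins \<open>v\<close> to the whole \<open>t\<close>-clique \<open>N\<close>,
  as a t-tree requires, while \<open>G\<close> joins it only to \<open>S\<close>. This freedom keeps
  the cliques of \<open>G\<close> small inside a t-tree.\<close>

lemma hosted_add_vertex:
  assumes h: "hosted t w G H" "clique H N" "card N = t" "S \<subseteq> N" "cliques_le G S (w - 1)" "0 < w"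
    and v: "v \<notin> verts G"
  shows "hosted t w (add_vertex G v S) (add_vertex H v N)"
proof -
  have G: "simple_graph G" "verts G = verts H" "t_tree t H" "edges G \<subseteq> edges H"
    "cliques_le G (verts G) w" using h unfolding hosted_def by auto
  have N: "N \<subseteq> verts G" using h(2) G(2) unfolding clique_def by auto
  have "t_tree t (add_vertex H v N)" using G h v by (auto intro: t_tree.add)
  moreover have "edges (add_vertex G v S) \<subseteq> edges (add_vertex H v N)"
    using G(4) h(4) unfolding add_vertex_def by auto
  moreover have "cliques_le (add_vertex G v S) (verts (add_vertex G v S)) w"
    using cliques_le_add_vertex[OF G(1) v _ G(5) h(5,6)] N h(4) by blast
  ultimately show ?thesis
    unfolding hosted_def using simple_graph_add_vertex[OF G(1) v] N h(4) G(2)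
    by (auto simp: add_vertex_def)
qed

lemma clique_add_vertex:
  assumes "clique H N"
  shows "clique (add_vertex H v N) (insert v N)"
  using assms unfolding clique_def add_vertex_def by (auto simp: insert_commute)

text \<open>A pair \<open>(N, S)\<close> is a request for a vertex. The finitely many requests posed
  in the original graphs are answered one after another; adjacency is prescribed only towards old
  vertices, so the answers do not interfere.\<close>

lemma exists_one_round_extension:
  assumes h: "hosted t w G H" and w: "0 < w"
  shows "\<exists>G' H'. hosted t w G' H' \<and> induced_subgraph G G' \<and> induced_subgraph H H' \<and>
    (\<forall>N S. clique H N \<and> card N = t \<and> S \<subseteq> N \<and> cliques_le G S (w - 1) \<longrightarrow>
       (\<exists>v\<in>verts G' - verts G. (\<forall>u\<in>verts G. {u, v} \<in> edges G' \<longleftrightarrow> u \<in> S) \<and>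
          clique H' (insert v N)))"
proof -
  define A where "A = {(N, S). clique H N \<and> card N = t \<and> S \<subseteq> N \<and> cliques_le G S (w - 1)}"
  have fin: "finite (verts G)" and GH: "verts G = verts H"
    using h unfolding hosted_def simple_graph_def by auto
  have "A \<subseteq> Pow (verts G) \<times> Pow (verts G)" unfolding A_def clique_def GH by auto
  then have "finite A" using fin by (meson finite_Pow_iff finite_SigmaI finite_subset)
  have "\<exists>G' H'. hosted t w G' H' \<and> induced_subgraph G G' \<and> induced_subgraph H H' \<and>
    (\<forall>(N, S)\<in>B. \<exists>v\<in>verts G' - verts G. (\<forall>u\<in>verts G. {u, v} \<in> edges G' \<longleftrightarrow> u \<in> S) \<and>
          clique H' (insert v N))" if "finite B" "B \<subseteq> A" for B
    using that
  proof (induction B rule: finite_induct)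
    case empty
    then show ?case using h induced_subgraph_refl by blast
  next
    case (insert x B)
    obtain N S where x: "x = (N, S)" by (cases x)
    then have NS: "clique H N" "card N = t" "S \<subseteq> N" "cliques_le G S (w - 1)"
      using insert.prems unfolding A_def by auto
    obtain G1 H1 where 1: "hosted t w G1 H1" "induced_subgraph G G1" "induced_subgraph H H1"
      "\<forall>(N, S)\<in>B. \<exists>v\<in>verts G1 - verts G. (\<forall>u\<in>verts G. {u, v} \<in> edges G1 \<longleftrightarrow> u \<in> S) \<and>
          clique H1 (insert v N)"
      using insert by blast
    have G1: "simple_graph G1" "verts G1 = verts H1"
      using 1(1) unfolding hosted_def by auto
    then have "finite (verts G1)" unfolding simple_graph_def by auto
    then obtain v where v: "v \<notin> verts G1" using ex_new_if_finite[OF infinite_UNIV_nat] by blast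
    have NG: "N \<subseteq> verts H" using NS unfolding clique_def by auto
    have N1: "clique H1 N" using NS clique_induced_subgraph[OF 1(3) NG] by blast
    have S1: "cliques_le G1 S (w - 1)"
      using NS NG GH cliques_le_induced_subgraph[OF 1(2), of S] by auto
    let ?G = "add_vertex G1 v S" and ?H = "add_vertex H1 v N"
    have host: "hosted t w ?G ?H"
      by (rule hosted_add_vertex[OF 1(1) N1 NS(2,3) S1 w v])
    have iG: "induced_subgraph G1 ?G" and iH: "induced_subgraph H1 ?H"
      using induced_subgraph_add_vertex v G1(2) by auto
    have sub: "verts G \<subseteq> verts G1" using 1(2) unfolding induced_subgraph_def by auto
    have new: "(\<forall>u\<in>verts G. {u, v} \<in> edges ?G \<longleftrightarrow> u \<in> S) \<and> clique ?H (insert v N)"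
      using edge_add_vertex[OF G1(1) v] sub clique_add_vertex[OF N1] by blast
    have vin: "v \<in> verts ?G - verts G" using v sub by (auto simp: add_vertex_def)
    \<comment> \<open>Earlier answers persist because both extensions are induced.\<close>
    have old: "\<exists>v\<in>verts ?G - verts G. (\<forall>u\<in>verts G. {u, v} \<in> edges ?G \<longleftrightarrow> u \<in> S') \<and>
          clique ?H (insert v N')" if B: "(N', S') \<in> B" for N' S'
    proof -
      obtain z where z: "z \<in> verts G1 - verts G" "\<forall>u\<in>verts G. {u, z} \<in> edges G1 \<longleftrightarrow> u \<in> S'"
          "clique H1 (insert z N')" using 1(4) B by blast
      have "clique ?H (insert z N')"
        using z(3) clique_induced_subgraph[OF iH] unfolding clique_def[of H1] by blast
      moreover have "\<forall>u\<in>verts G. {u, z} \<in> edges ?G \<longleftrightarrow> u \<in> S'"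
        using z(1,2) iG sub unfolding induced_subgraph_def by blast
      moreover have "z \<in> verts ?G - verts G" using z(1) iG unfolding induced_subgraph_def by blast
      ultimately show ?thesis by blast
    qed
    have "induced_subgraph G ?G" "induced_subgraph H ?H"
      using induced_subgraph_trans 1 iG iH by blast+
    then show ?case using host new vin old x by blast
  qed
  from this[OF \<open>finite A\<close> subset_refl] show ?thesis unfolding A_def by simp
qed

section \<open>Playing inside a universal extension\<close>

text \<open>
  X stands for a set of vertices forming a clique of the host t-tree, and d is the number of moves
  still available from X: a move adds a vertex and then discards all but at most t vertices. The
  predicate does not mention the host, so the search for pairs takes place in one fixed graph.
\<close>
primrec playable :: "graph \<Rightarrow> nat \<Rightarrow> nat \<Rightarrow> nat \<Rightarrow> nat set \<Rightarrow> bool" where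
  "playable G t w 0 X \<longleftrightarrow> X \<subseteq> verts G"
| "playable G t w (Suc d) X \<longleftrightarrow> X \<subseteq> verts G \<and>
     (\<forall>S\<subseteq>X. cliques_le G S (w - 1) \<longrightarrow>
       (\<exists>v\<in>verts G - X. (\<forall>u\<in>X. {u, v} \<in> edges G \<longleftrightarrow> u \<in> S) \<and>
          (\<forall>Y\<subseteq>insert v X. card Y \<le> t \<longrightarrow> playable G t w d Y)))"

lemma playable_verts: "playable G t w d X \<Longrightarrow> X \<subseteq> verts G"
  by (cases d) auto

declare playable.simps(2) [simp del]

lemma playable_move:
  assumes "playable G t w (Suc d) X" "S \<subseteq> X" "cliques_le G S (w - 1)"
  obtains v where "v \<in> verts G" "v \<notin> X" "\<And>u. u \<in> X \<Longrightarrow> {u, v} \<in> edges G \<longleftrightarrow> u \<in> S"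
    "\<And>Y. Y \<subseteq> insert v X \<Longrightarrow> card Y \<le> t \<Longrightarrow> playable G t w d Y"
proof -
  have "\<exists>v\<in>verts G - X. (\<forall>u\<in>X. {u, v} \<in> edges G \<longleftrightarrow> u \<in> S) \<and>
      (\<forall>Y\<subseteq>insert v X. card Y \<le> t \<longrightarrow> playable G t w d Y)"
    using assms unfolding playable.simps by blast
  then obtain v where v: "v \<in> verts G - X" "\<forall>u\<in>X. {u, v} \<in> edges G \<longleftrightarrow> u \<in> S"
      "\<forall>Y\<subseteq>insert v X. card Y \<le> t \<longrightarrow> playable G t w d Y" by (elim bexE conjE)
  show ?thesis by (rule that[of v]) (use v in auto)
qed

lemma playable_subset:
  assumes "playable G t w d X" "Y \<subseteq> X"
  shows "playable G t w d Y"
proof (cases d)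
  case 0
  then show ?thesis using assms by auto
next
  case (Suc e)
  show ?thesis unfolding Suc playable.simps
  proof (intro conjI allI impI)
    show "Y \<subseteq> verts G" using playable_verts[OF assms(1)] assms(2) by (rule order_trans[rotated])
    fix S assume S: "S \<subseteq> Y" "cliques_le G S (w - 1)"
    obtain v where v: "v \<in> verts G" "v \<notin> X" "\<And>u. u \<in> X \<Longrightarrow> {u, v} \<in> edges G \<longleftrightarrow> u \<in> S"
      "\<And>Y. Y \<subseteq> insert v X \<Longrightarrow> card Y \<le> t \<Longrightarrow> playable G t w e Y"
      using playable_move[OF assms(1)[unfolded Suc] order_trans[OF S(1) assms(2)] S(2)] by metis
    show "\<exists>v\<in>verts G - Y. (\<forall>u\<in>Y. ({u, v} \<in> edges G) = (u \<in> S)) \<and>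
       (\<forall>Z\<subseteq>insert v Y. card Z \<le> t \<longrightarrow> playable G t w e Z)"
    proof (intro bexI[of _ v] conjI ballI allI impI)
      show "playable G t w e Z" if "Z \<subseteq> insert v Y" "card Z \<le> t" for Z
        by (rule v(4)) (use that assms(2) in auto)
    qed (use v assms(2) in auto)
  qed
qed

lemma playable_Suc: "playable G t w (Suc d) X \<Longrightarrow> playable G t w d X"
proof (induction d arbitrary: X)
  case 0
  then show ?case by (simp add: playable_verts)
next
  case (Suc d)
  show ?case unfolding playable.simps(2)[of G t w d]
  proof (intro conjI allI impI)
    show "X \<subseteq> verts G" using Suc.prems by (rule playable_verts)
    fix S assume S: "S \<subseteq> X" "cliques_le G S (w - 1)"
    obtain v where v: "v \<in> verts G" "v \<notin> X" "\<And>u. u \<in> X \<Longrightarrow> {u, v} \<in> edges G \<longleftrightarrow> u \<in> S"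
      "\<And>Y. Y \<subseteq> insert v X \<Longrightarrow> card Y \<le> t \<Longrightarrow> playable G t w (Suc d) Y"
      using playable_move[OF Suc.prems S] by metis
    show "\<exists>v\<in>verts G - X. (\<forall>u\<in>X. ({u, v} \<in> edges G) = (u \<in> S)) \<and>
       (\<forall>Y\<subseteq>insert v X. card Y \<le> t \<longrightarrow> playable G t w d Y)"
    proof (intro bexI[of _ v] conjI ballI allI impI)
      show "playable G t w d Y" if "Y \<subseteq> insert v X" "card Y \<le> t" for Y
        by (rule Suc.IH, rule v(4)) (use that in auto)
    qed (use v in auto)
  qed
qed

lemma playable_mono:
  assumes "playable G t w d X" "d' \<le> d"
  shows "playable G t w d' X"
  using assms(2,1) by (induction rule: inc_induct) (simp_all only: playable_Suc)

text \<open>One round answers every first move made inside a \<open>t\<close>-clique of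
  \<open>H\<close>. The clique \<open>insert v N\<close> of the new host contains every next
  position, so the remaining \<open>d\<close> moves are answered by induction, starting from the
  enlarged graphs.\<close>

lemma exists_playable_extension:
  assumes "hosted t w G H" "0 < w"
  shows "\<exists>G' H'. hosted t w G' H' \<and> induced_subgraph G G' \<and>
    (\<forall>N X. clique H N \<and> card N = t \<and> X \<subseteq> N \<longrightarrow> playable G' t w d X)"
  using assms(1)
proof (induction d arbitrary: G H)
  case 0
  then have "verts G = verts H" by (simp add: hosted_def)
  then have "\<forall>N X. clique H N \<and> card N = t \<and> X \<subseteq> N \<longrightarrow> playable G t w 0 X"
    by (auto simp: clique_def)
  then show ?case using 0 induced_subgraph_refl
    by - (rule exI[of _ G], rule exI[of _ H], intro conjI)
next
  case (Suc d)
  obtain G1 H1 where 1: "hosted t w G1 H1" "induced_subgraph G G1" "induced_subgraph H H1"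
    and ext: "\<forall>N S. clique H N \<and> card N = t \<and> S \<subseteq> N \<and> cliques_le G S (w - 1) \<longrightarrow>
       (\<exists>v\<in>verts G1 - verts G. (\<forall>u\<in>verts G. {u, v} \<in> edges G1 \<longleftrightarrow> u \<in> S) \<and>
          clique H1 (insert v N))"
    using exists_one_round_extension[OF Suc.prems assms(2)] by (elim exE conjE) (rule that)
  obtain G2 H2 where 2: "hosted t w G2 H2" "induced_subgraph G1 G2"
    and play: "\<forall>N X. clique H1 N \<and> card N = t \<and> X \<subseteq> N \<longrightarrow> playable G2 t w d X"
    using Suc.IH[OF 1(1)] by (elim exE conjE) (rule that)
  have 02: "induced_subgraph G G2" using 1 2 induced_subgraph_trans by blast
  have sub: "verts G \<subseteq> verts G1" "verts G1 \<subseteq> verts G2"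
    using 1 2 unfolding induced_subgraph_def by auto
  have GH: "verts G = verts H" "finite (verts G)"
    using Suc.prems by (auto simp: hosted_def simple_graph_def)
  have "playable G2 t w (Suc d) X" if X: "clique H N" "card N = t" "X \<subseteq> N" for N X
    unfolding playable.simps
  proof (intro conjI allI impI)
    have NG: "N \<subseteq> verts G" using X GH unfolding clique_def by auto
    then show "X \<subseteq> verts G2" using X sub by blast
    fix S assume S: "S \<subseteq> X" "cliques_le G2 S (w - 1)"
    have "cliques_le G S (w - 1)" using cliques_le_induced_subgraph[OF 02, of S] S NG X by blast
    then obtain v where v: "v \<in> verts G1 - verts G" "\<forall>u\<in>verts G. {u, v} \<in> edges G1 \<longleftrightarrow> u \<in> S"
      "clique H1 (insert v N)" using ext[rule_format, of N S] S X by auto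
    have "\<forall>u\<in>X. {u, v} \<in> edges G2 \<longleftrightarrow> u \<in> S"
      using v(1,2) 2(2) sub X NG unfolding induced_subgraph_def by blast
    moreover have "playable G2 t w d Y" if Y: "Y \<subseteq> insert v X" "card Y \<le> t" for Y
    proof -
      have fN: "finite N" using NG GH finite_subset by blast
      have cN: "t \<le> card (insert v N)" using X(2) fN by (simp add: card_insert_if)
      \<comment> \<open>The induction hypothesis speaks of subsets of \<open>t\<close>-cliques of
        the host, so the next position is enlarged to exactly \<open>t\<close> vertices of
        \<open>insert v N\<close>.\<close>
      have "Y \<subseteq> insert v N" using Y X by blast
      from exists_subset_between[OF Y(2) cN this] fN
      obtain M where M: "Y \<subseteq> M" "M \<subseteq> insert v N" "card M = t" by auto
      show ?thesis using play clique_subset[OF v(3) M(2)] M(1,3) by blast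
    qed
    moreover have "v \<in> verts G2 - X" using v sub X NG by blast
    ultimately show "\<exists>v\<in>verts G2 - X. (\<forall>u\<in>X. ({u, v} \<in> edges G2) = (u \<in> S)) \<and>
       (\<forall>Y\<subseteq>insert v X. card Y \<le> t \<longrightarrow> playable G2 t w d Y)" by blast
  qed
  then have "\<forall>N X. clique H N \<and> card N = t \<and> X \<subseteq> N \<longrightarrow> playable G2 t w (Suc d) X" by blast
  then show ?case using 2(1) 02 by - (rule exI[of _ G2], rule exI[of _ H2], intro conjI)
qed

text \<open>Each of the \<open>n\<close> moves prescribes the neighborhood
  \<open>S \<union> V\<close> within \<open>X \<union> V\<close>, where \<open>V\<close> is the
  clique built so far. A position must fit into \<open>t\<close> vertices only before a move, hence
  the bound \<open>t + 1\<close> on the total; at the last move the prescribed neighborhood has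
  cliques of at most \<open>q + n - 1 \<le> w - 1\<close> vertices.\<close>

lemma playable_add_clique:
  assumes "playable G t w (d + n) X" "finite X" "S \<subseteq> X" "cliques_le G S q"
    and "card X + n \<le> t + 1" "q + n \<le> w" "card X \<le> t"
  shows "\<exists>V. V \<subseteq> verts G \<and> finite V \<and> card V = n \<and> V \<inter> X = {} \<and> clique G V \<and>
    (\<forall>u\<in>X. \<forall>v\<in>V. {u, v} \<in> edges G \<longleftrightarrow> u \<in> S) \<and>
    (\<forall>Y\<subseteq>X \<union> V. card Y \<le> t \<longrightarrow> playable G t w d Y)"
  using assms(1,5,6)
proof (induction n arbitrary: d)
  case 0
  then have "playable G t w d X" by simp
  then show ?case using playable_subset by (intro exI[of _ "{}"]) (auto simp: clique_def)
next
  case (Suc n)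
  have "playable G t w (Suc d + n) X" using Suc.prems(1) by simp
  from Suc.IH[OF this] Suc.prems obtain V where V: "V \<subseteq> verts G" "finite V" "card V = n"
    "V \<inter> X = {}" "clique G V" "\<forall>u\<in>X. \<forall>v\<in>V. {u, v} \<in> edges G \<longleftrightarrow> u \<in> S"
    and play: "\<forall>Y\<subseteq>X \<union> V. card Y \<le> t \<longrightarrow> playable G t w (Suc d) Y" by auto
  have "card (X \<union> V) \<le> t"
    using card_Un_le[of X V] Suc.prems(2) V(3) by linarith
  then have "playable G t w (Suc d) (X \<union> V)" using play by blast
  moreover have "S \<union> V \<subseteq> X \<union> V" using assms(3) by blast
  moreover have "cliques_le G (S \<union> V) (w - 1)"
    using cliques_le_mono[OF cliques_le_Un[OF assms(4) cliques_le_card[OF V(2)]]] V(3) Suc.prems(3)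
    by simp
  ultimately obtain v where v: "v \<in> verts G" "v \<notin> X \<union> V"
    and adj: "\<And>u. u \<in> X \<union> V \<Longrightarrow> {u, v} \<in> edges G \<longleftrightarrow> u \<in> S \<union> V"
    and move: "\<And>Y. Y \<subseteq> insert v (X \<union> V) \<Longrightarrow> card Y \<le> t \<Longrightarrow> playable G t w d Y"
    by (rule playable_move) metis
  show ?case
  proof (intro exI[of _ "insert v V"] conjI)
    show "card (insert v V) = Suc n" using V v by simp
    show "clique G (insert v V)"
      using V(5) v adj unfolding clique_def by (auto simp: insert_commute[of v])
    show "\<forall>u\<in>X. \<forall>z\<in>insert v V. ({u, z} \<in> edges G) = (u \<in> S)"
      using V(4,6) adj by auto
    show "\<forall>Y\<subseteq>X \<union> insert v V. card Y \<le> t \<longrightarrow> playable G t w d Y"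
      using move by simp
  qed (use V v in auto)
qed

section \<open>Treewidth and clique number\<close>

text \<open>Degeneracy: the vertex of \<open>A\<close> added last has at most \<open>s\<close>
  neighbors in \<open>A\<close>, and if \<open>A\<close> lies inside the initial clique there are
  only \<open>s\<close> vertices altogether.\<close>

lemma t_tree_degenerate:
  assumes "t_tree s H" "A \<subseteq> verts H" "A \<noteq> {}"
  shows "\<exists>a\<in>A. card {b\<in>A. {a, b} \<in> edges H} \<le> s"
  using assms
proof (induction rule: t_tree.induct)
  case (start S)
  then obtain a where "a \<in> A" by blast
  have "{b\<in>A. {a, b} \<in> edges (complete_graph S)} \<subseteq> S"
    using start by (auto simp: complete_graph_def)
  from card_mono[OF start(1) this] start(2) have "card {b\<in>A. {a, b} \<in> edges (complete_graph S)} \<le> s"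
    by simp
  then show ?case using \<open>a \<in> A\<close> by blast
next
  case (add H v N)
  have sH: "simple_graph H" using add.hyps(1) by (rule simple_graph_t_tree)
  have fN: "finite N" using add.hyps(3) sH finite_subset unfolding clique_def simple_graph_def by blast
  show ?case
  proof (cases "v \<in> A")
    case True
    have "{b\<in>A. {v, b} \<in> edges (add_vertex H v N)} \<subseteq> N"
    proof
      fix b assume "b \<in> {b\<in>A. {v, b} \<in> edges (add_vertex H v N)}"
      then have b: "b \<in> A" "{b, v} \<in> edges (add_vertex H v N)" by (auto simp: insert_commute)
      have "simple_graph (add_vertex H v N)"
        using simple_graph_add_vertex[OF sH add.hyps(2)] add.hyps(3) unfolding clique_def by blast
      then have "b \<noteq> v" using simple_graph_edge b(2) by blast
      then have "b \<in> verts H" using b(1) add.prems by (auto simp: add_vertex_def)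
      then show "b \<in> N" using edge_add_vertex[OF sH add.hyps(2)] b(2) by blast
    qed
    then have "card {b\<in>A. {v, b} \<in> edges (add_vertex H v N)} \<le> s"
      using add.hyps(4) card_mono[OF fN] by blast
    then show ?thesis using True by blast
  next
    case False
    then have A: "A \<subseteq> verts H" using add.prems by (auto simp: add_vertex_def)
    then obtain a where a: "a \<in> A" "card {b\<in>A. {a, b} \<in> edges H} \<le> s"
      using add.IH add.prems(2) by blast
    have "{b\<in>A. {a, b} \<in> edges (add_vertex H v N)} = {b\<in>A. {a, b} \<in> edges H}"
      using induced_subgraph_add_vertex[OF add.hyps(2), of N] A a(1)
      unfolding induced_subgraph_def by blast
    then have "card {b\<in>A. {a, b} \<in> edges (add_vertex H v N)} \<le> s" using a(2) by (simp only:)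
    then show ?thesis using a(1) by blast
  qed
qed

text \<open>Starting the extension from this graph forces the treewidth of the result up to t.\<close>
lemma exists_hosted_complete_bipartite:
  assumes "2 \<le> w"
  shows "\<exists>G H A B. hosted t w G H \<and> clique H A \<and> card A = t \<and> B \<subseteq> verts G \<and> card B = n \<and>
    A \<inter> B = {} \<and> (\<forall>a\<in>A. \<forall>b\<in>B. {a, b} \<in> edges G) \<and> cliques_le G A 1"
proof (induction n)
  case 0
  \<comment> \<open>The start is an edgeless graph in a complete host: \<open>A\<close> is a
    \<open>t\<close>-clique of the host but independent in \<open>G\<close>, so with
    \<open>2 \<le> w\<close> every later vertex may be joined to all of \<open>A\<close>.\<close>
  let ?A = "{..<t}"
  let ?G = "\<lparr>verts = ?A, edges = {}\<rparr>"
  have ind: "cliques_le ?G ?A 1" by (rule cliques_le_independent) auto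
  have "hosted t w ?G (complete_graph ?A)"
    unfolding hosted_def using t_tree.start[of ?A t] cliques_le_mono[OF ind] assms
    by (auto simp: complete_graph_def simple_graph_def)
  moreover have "clique (complete_graph ?A) ?A" by (auto simp: clique_def complete_graph_def)
  ultimately show ?case using ind
    by - (rule exI[of _ ?G], rule exI[of _ "complete_graph ?A"], rule exI[of _ ?A], rule exI[of _ "{}"], auto)
next
  case (Suc n)
  then obtain G H A B where h: "hosted t w G H" "clique H A" "card A = t" "B \<subseteq> verts G" "card B = n"
    "A \<inter> B = {}" "\<forall>a\<in>A. \<forall>b\<in>B. {a, b} \<in> edges G" "cliques_le G A 1" by blast
  have G: "simple_graph G" "finite (verts G)" "verts G = verts H"
    using h(1) by (auto simp: hosted_def simple_graph_def)
  obtain v where v: "v \<notin> verts G" using ex_new_if_finite[OF infinite_UNIV_nat G(2)] by blast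
  have A: "A \<subseteq> verts G" using h(2) G(3) by (auto simp: clique_def)
  have ind: "induced_subgraph G (add_vertex G v A)" by (rule induced_subgraph_add_vertex[OF v])
  have "cliques_le G A (w - 1)" using cliques_le_mono[OF h(8)] assms by auto
  then have "hosted t w (add_vertex G v A) (add_vertex H v A)"
    using hosted_add_vertex[OF h(1-3) subset_refl _ _ v] assms by auto
  moreover have "clique (add_vertex H v A) A" using clique_subset[OF clique_add_vertex[OF h(2)]] by blast
  moreover have "v \<notin> B" "finite B" using h(4) v G(2) finite_subset by auto
  then have "card (insert v B) = Suc n" using h(5) by simp
  moreover have "cliques_le (add_vertex G v A) A 1" using h(8) cliques_le_induced_subgraph[OF ind A] by blast
  moreover have "\<forall>a\<in>A. \<forall>b\<in>insert v B. {a, b} \<in> edges (add_vertex G v A)"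
    using h(7) edge_add_vertex[OF G(1) v] A by (auto simp: add_vertex_def)
  moreover have "insert v B \<subseteq> verts (add_vertex G v A)" using h(4) by (auto simp: add_vertex_def)
  moreover have "A \<inter> insert v B = {}" using h(6) v A by auto
  moreover note h(3)
  ultimately show ?case
    by - (rule exI[of _ "add_vertex G v A"], rule exI[of _ "add_vertex H v A"], rule exI[of _ A],
      rule exI[of _ "insert v B"], intro conjI)
qed

text \<open>Every vertex of \<open>A \<union> B\<close> has at least \<open>t\<close> neighbors in
  that set, whereas degeneracy of an \<open>s\<close>-tree containing \<open>G\<close> yields one
  with at most \<open>s\<close>.\<close>

lemma treewidth_ge_complete_bipartite:
  assumes p: "partial_t_tree s G"
    and AB: "A \<subseteq> verts G" "B \<subseteq> verts G" "card A = t" "card B = t" "A \<inter> B = {}"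
      "\<forall>a\<in>A. \<forall>b\<in>B. {a, b} \<in> edges G"
  shows "t \<le> s"
proof (cases "t = 0")
  case False
  obtain H where H: "t_tree s H" "verts G \<subseteq> verts H" "edges G \<subseteq> edges H" "finite (verts G)"
    using p by (auto simp: partial_t_tree_def subgraph_def simple_graph_def)
  let ?U = "A \<union> B"
  have "?U \<noteq> {}" using AB(3) False by auto
  then obtain x where x: "x \<in> ?U" "card {b\<in>?U. {x, b} \<in> edges H} \<le> s"
    using t_tree_degenerate[OF H(1), of ?U] AB H by blast
  have fin: "finite {b\<in>?U. {x, b} \<in> edges H}" using AB H(4) finite_subset[of ?U] by auto
  have "A \<subseteq> {b\<in>?U. {x, b} \<in> edges H} \<or> B \<subseteq> {b\<in>?U. {x, b} \<in> edges H}"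
  proof (cases "x \<in> A")
    case True
    then have "B \<subseteq> {b\<in>?U. {x, b} \<in> edges H}" using AB(6) H(3) by auto
    then show ?thesis ..
  next
    case False
    then have "{x, a} \<in> edges H" if "a \<in> A" for a
      using that x(1) AB(6) H(3) insert_commute[of x a "{}"] by auto
    then have "A \<subseteq> {b\<in>?U. {x, b} \<in> edges H}" by auto
    then show ?thesis ..
  qed
  then have "t \<le> card {b\<in>?U. {x, b} \<in> edges H}"
    using card_mono[OF fin, of A] card_mono[OF fin, of B] AB(3,4) by linarith
  then show ?thesis using x(2) by linarith
qed auto

text \<open>The host witnesses the upper bound, the complete bipartite subgraph the lower
  one.\<close>

lemma treewidth_hosted:
  assumes h: "hosted t w G H"
    and AB: "A \<subseteq> verts G" "B \<subseteq> verts G" "card A = t" "card B = t" "A \<inter> B = {}"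
      "\<forall>a\<in>A. \<forall>b\<in>B. {a, b} \<in> edges G"
  shows "treewidth G = t"
  unfolding treewidth_def
proof (rule Least_equality)
  show "partial_t_tree t G"
    unfolding partial_t_tree_def subgraph_def
    using h simple_graph_t_tree by (intro exI[of _ H]) (auto simp: hosted_def)
  show "t \<le> s" if "partial_t_tree s G" for s
    using treewidth_ge_complete_bipartite[OF that AB] .
qed

lemma clique_number_eqI:
  assumes "simple_graph G" "cliques_le G (verts G) w" "clique G K" "card K = w"
  shows "clique_number G = w"
  unfolding clique_number_def
proof (rule Max_eqI)
  have "{card K |K. clique G K} \<subseteq> card ` Pow (verts G)" by (auto simp: clique_def)
  then show "finite {card K |K. clique G K}"
    using assms(1) finite_subset by (fastforce simp: simple_graph_def)
  show "k \<le> w" if "k \<in> {card K |K. clique G K}" for k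
    using that assms(2) by (auto simp: cliques_le_def clique_def)
  show "w \<in> {card K |K. clique G K}" using assms(3,4) by blast
qed

section \<open>Overlaps of color sets\<close>

text \<open>Unit intervals at distinct integers are disjoint. The set under the infimum is therefore
  nonempty, so a bound valid for every coloring bounds the real-valued \<open>Inf\<close>.\<close>

lemma exists_fractional_coloring:
  assumes "simple_graph G"
  shows "\<exists>\<phi>. fractional_coloring G \<phi>"
proof (intro exI)
  let ?\<phi> = "\<lambda>v::nat. {real v..<real v + 1}"
  have "?\<phi> u \<inter> ?\<phi> v = {}" if "{u, v} \<in> edges G" for u v
  proof -
    have "u \<noteq> v" using simple_graph_edge(3)[OF assms that] .
    then consider "u + 1 \<le> v" | "v + 1 \<le> u" by linarith
    then show ?thesis by cases (auto simp flip: of_nat_Suc)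
  qed
  moreover have "{real v..<real v + 1} \<in> lmeasurable" for v
    by (rule fmeasurableI) auto
  ultimately show "fractional_coloring G ?\<phi>" by (simp add: fractional_coloring_def del: Int_atLeastLessThan)
qed

lemma fractional_chromatic_number_geI:
  assumes "simple_graph G"
    and "\<And>\<phi>. fractional_coloring G \<phi> \<Longrightarrow> b \<le> measure lebesgue (\<Union>v\<in>verts G. \<phi> v)"
  shows "b \<le> fractional_chromatic_number G"
  unfolding fractional_chromatic_number_def
  using exists_fractional_coloring[OF assms(1)] assms(2) by (intro cInf_greatest) auto

section \<open>The deficit of a vertex set in a fixed coloring\<close>

locale colored_graph =
  fixes G :: graph and \<phi> :: "nat \<Rightarrow> real set"
  assumes simple: "simple_graph G" and coloring: "fractional_coloring G \<phi>"
begin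

text \<open>The measure lost through overlaps, compared with pairwise disjoint color sets. Unlike
  the overlaps themselves, it needs no bookkeeping of pairs and adds up over completely joined
  sets.\<close>

definition deficit :: "nat set \<Rightarrow> real" where
  "deficit X = real (card X) - measure lebesgue (\<Union>v\<in>X. \<phi> v)"

lemma color_lmeasurable: "v \<in> verts G \<Longrightarrow> \<phi> v \<in> lmeasurable"
  and color_measure: "v \<in> verts G \<Longrightarrow> measure lebesgue (\<phi> v) = 1"
  and color_disjoint: "{u, v} \<in> edges G \<Longrightarrow> \<phi> u \<inter> \<phi> v = {}"
  using coloring unfolding fractional_coloring_def by auto

lemma finite_subset_verts: "X \<subseteq> verts G \<Longrightarrow> finite X"
  using simple finite_subset unfolding simple_graph_def by blast

lemma union_lmeasurable:
  assumes "X \<subseteq> verts G"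
  shows "(\<Union>v\<in>X. \<phi> v) \<in> lmeasurable"
  by (rule fmeasurable.finite_UN) (use assms finite_subset_verts color_lmeasurable in auto)

text \<open>Completely joined sets use disjoint sets of colors, so cardinality and measure both
  add.\<close>

lemma deficit_Un:
  assumes "X \<subseteq> verts G" "Y \<subseteq> verts G" "X \<inter> Y = {}"
    and adj: "\<And>u v. u \<in> X \<Longrightarrow> v \<in> Y \<Longrightarrow> {u, v} \<in> edges G"
  shows "deficit (X \<union> Y) = deficit X + deficit Y"
proof -
  have "(\<Union>v\<in>X. \<phi> v) \<inter> (\<Union>v\<in>Y. \<phi> v) = {}" using adj color_disjoint by blast
  then have "measure lebesgue ((\<Union>v\<in>X. \<phi> v) \<union> (\<Union>v\<in>Y. \<phi> v))
      = measure lebesgue (\<Union>v\<in>X. \<phi> v) + measure lebesgue (\<Union>v\<in>Y. \<phi> v)"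
    using measure_Un3[OF union_lmeasurable[OF assms(1)] union_lmeasurable[OF assms(2)]] by simp
  moreover have "card (X \<union> Y) = card X + card Y"
    using assms finite_subset_verts by (simp add: card_Un_disjoint)
  ultimately show ?thesis by (simp add: deficit_def UN_Un)
qed

lemma deficit_empty: "deficit {} = 0"
  by (simp add: deficit_def)

lemma deficit_pair:
  assumes "u \<in> verts G" "v \<in> verts G" "u \<noteq> v"
  shows "deficit {u, v} = measure lebesgue (\<phi> u \<inter> \<phi> v)"
  using measure_Un3[of "\<phi> u" lebesgue "\<phi> v"] assms
  by (simp add: deficit_def color_lmeasurable color_measure)

lemma deficit_clique:
  assumes "clique G V"
  shows "deficit V = 0"
proof -
  have "V \<subseteq> verts G" using assms by (simp add: clique_def)
  then have "finite V" by (rule finite_subset_verts)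
  then show ?thesis using assms
  proof (induction V rule: finite_induct)
    case empty
    then show ?case by (simp add: deficit_empty)
  next
    case (insert v V)
    have V: "clique G V" using insert.prems by (rule clique_subset) auto
    have "{v, u} \<in> edges G" if "u \<in> V" for u
      using that insert.prems insert.hyps(2) by (simp add: clique_def) metis
    then have "deficit ({v} \<union> V) = deficit {v} + deficit V"
      using insert.prems insert.hyps(2) by (intro deficit_Un) (simp_all add: clique_def)
    moreover have "deficit {v} = 0"
      using insert.prems color_measure by (simp add: deficit_def clique_def)
    ultimately show ?case using insert.IH[OF V] by simp
  qed
qed

text \<open>The colors of \<open>X\<close> are covered by \<open>A\<close> and the pieces
  \<open>\<phi> w - A\<close>, of measure \<open>1 - measure lebesgue (A \<inter> \<phi> w)\<close>.
  Comparing with \<open>card X - deficit X\<close> and rearranging gives the bound.\<close>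

lemma sum_measure_Int_le:
  assumes X: "X \<subseteq> verts G" and A: "A \<in> lmeasurable"
  shows "(\<Sum>w\<in>X. measure lebesgue (A \<inter> \<phi> w)) \<le> measure lebesgue A + deficit X"
proof -
  have fin: "finite X" using X by (rule finite_subset_verts)
  have m: "\<phi> w \<in> lmeasurable" "measure lebesgue (\<phi> w) = 1" if "w \<in> X" for w
    using that X color_lmeasurable color_measure by auto
  let ?U = "\<Union>v\<in>X. \<phi> v"
  have U: "?U \<in> lmeasurable" by (rule union_lmeasurable[OF X])
  have "measure lebesgue ?U \<le> measure lebesgue (A \<union> (?U - A))"
    by (rule measure_mono_fmeasurable) (use A U in \<open>auto intro!: fmeasurable.Un fmeasurable.Diff\<close>)
  also have "\<dots> \<le> measure lebesgue A + measure lebesgue (?U - A)"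
    by (rule measure_Un_le) (use A U in auto)
  also have "?U - A = (\<Union>w\<in>X. \<phi> w - A)" by blast
  also have "measure lebesgue (\<Union>w\<in>X. \<phi> w - A) \<le> (\<Sum>w\<in>X. measure lebesgue (\<phi> w - A))"
    by (rule measure_UNION_le[OF fin]) (use m A in auto)
  also have "(\<Sum>w\<in>X. measure lebesgue (\<phi> w - A)) = (\<Sum>w\<in>X. 1 - measure lebesgue (A \<inter> \<phi> w))"
  proof (rule sum.cong[OF refl])
    fix w assume w: "w \<in> X"
    have "\<phi> w - A \<in> lmeasurable" "A \<inter> \<phi> w \<in> lmeasurable"
      using m(1)[OF w] A by auto
    moreover have "(\<phi> w - A) \<inter> (A \<inter> \<phi> w) = {}" by blast
    ultimately have "measure lebesgue ((\<phi> w - A) \<union> (A \<inter> \<phi> w))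
        = measure lebesgue (\<phi> w - A) + measure lebesgue (A \<inter> \<phi> w)"
      by (simp add: measure_Un3)
    moreover have "(\<phi> w - A) \<union> (A \<inter> \<phi> w) = \<phi> w" by blast
    ultimately show "measure lebesgue (\<phi> w - A) = 1 - measure lebesgue (A \<inter> \<phi> w)"
      using m(2)[OF w] by simp
  qed
  finally show ?thesis by (simp add: deficit_def sum_subtractf)
qed

text \<open>Averaging over the \<open>card L * card K\<close> pairs. The color sets of the clique
  \<open>L\<close> are disjoint, so their union has measure \<open>card L\<close> and its overlap
  with each \<open>\<phi> w\<close> is the sum of the overlaps with the single vertices of
  \<open>L\<close>.\<close>

lemma exists_pair_small_overlap:
  assumes K: "K \<subseteq> verts G" "K \<noteq> {}" and L: "clique G L" "L \<noteq> {}"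
  shows "\<exists>v\<in>L. \<exists>w\<in>K. measure lebesgue (\<phi> v \<inter> \<phi> w)
           \<le> (real (card L) + deficit K) / (real (card L) * real (card K))"
proof (rule ccontr)
  let ?c = "(real (card L) + deficit K) / (real (card L) * real (card K))"
  assume "\<not> ?thesis"
  then have gt: "?c < measure lebesgue (\<phi> v \<inter> \<phi> w)" if "v \<in> L" "w \<in> K" for v w
    using that by (simp only: not_le bex_simps ball_simps)
  have LV: "L \<subseteq> verts G" using L by (simp add: clique_def)
  have fin: "finite K" "finite L" using K LV finite_subset_verts by auto
  then have pos: "card K > 0" "card L > 0" using K L by (auto simp: card_gt_0_iff)
  let ?A = "\<Union>v\<in>L. \<phi> v"
  have A: "?A \<in> lmeasurable" by (rule union_lmeasurable[OF LV])
  have "measure lebesgue ?A = card L" using deficit_clique[OF L(1)] by (simp add: deficit_def)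
  then have "(\<Sum>w\<in>K. measure lebesgue (?A \<inter> \<phi> w)) \<le> card L + deficit K"
    using sum_measure_Int_le[OF K(1) A] by simp
  moreover have "measure lebesgue (?A \<inter> \<phi> w) = (\<Sum>v\<in>L. measure lebesgue (\<phi> v \<inter> \<phi> w))"
    if "w \<in> K" for w
  proof -
    have disj: "disjoint_family_on (\<lambda>v. \<phi> v \<inter> \<phi> w) L"
      unfolding disjoint_family_on_def
    proof (intro ballI impI)
      fix u v assume "u \<in> L" "v \<in> L" "u \<noteq> v"
      then have "\<phi> u \<inter> \<phi> v = {}" using L(1) color_disjoint by (simp add: clique_def)
      then show "\<phi> u \<inter> \<phi> w \<inter> (\<phi> v \<inter> \<phi> w) = {}" by blast
    qed
    have m: "\<phi> v \<inter> \<phi> w \<in> lmeasurable" if v: "v \<in> L" for v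
      using color_lmeasurable v \<open>w \<in> K\<close> LV K(1) by (intro fmeasurable.Int) auto
    have "measure lebesgue (\<Union>v\<in>L. \<phi> v \<inter> \<phi> w) = (\<Sum>v\<in>L. measure lebesgue (\<phi> v \<inter> \<phi> w))"
    proof (rule measure_finite_Union[OF fin(2) _ disj])
      show "(\<lambda>v. \<phi> v \<inter> \<phi> w) ` L \<subseteq> sets lebesgue" using m by (auto dest: fmeasurableD)
      show "emeasure lebesgue (\<phi> v \<inter> \<phi> w) \<noteq> \<infinity>" if "v \<in> L" for v
        using fmeasurableD2[OF m[OF that]] by simp
    qed
    moreover have "?A \<inter> \<phi> w = (\<Union>v\<in>L. \<phi> v \<inter> \<phi> w)" by blast
    ultimately show ?thesis by (simp only:)
  qed
  ultimately have "(\<Sum>w\<in>K. \<Sum>v\<in>L. measure lebesgue (\<phi> v \<inter> \<phi> w)) \<le> card L + deficit K" by simp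
  moreover have "(\<Sum>w\<in>K. \<Sum>v\<in>L. ?c) < (\<Sum>w\<in>K. \<Sum>v\<in>L. measure lebesgue (\<phi> v \<inter> \<phi> w))"
    using gt fin K L by (intro sum_strict_mono) auto
  moreover have "(\<Sum>w\<in>K. \<Sum>v\<in>L. ?c) = card L + deficit K" using pos by simp
  ultimately show False by simp
qed

section \<open>Searching for pairs with small overlap\<close>

text \<open>Each of the \<open>j\<close> rounds builds an \<open>s\<close>-clique \<open>V\<close>
  joined to \<open>S \<union> K\<close>, then a vertex \<open>v\<close> joined to
  \<open>S \<union> K\<close> but to nothing in \<open>V\<close>. Some \<open>x\<close> in
  \<open>V\<close> overlaps \<open>v\<close> in at most \<open>1 / s\<close>; the pair enters
  \<open>K\<close> and the rest of \<open>V\<close> is discarded. Thus \<open>K\<close> consists of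
  non-adjacent pairs completely joined to each other: a clique meets each pair at most once, and the
  deficits add.\<close>

lemma playable_low_deficit_pairs:
  assumes "playable G t w (d + j * (s + 1)) X" "finite X" "S \<subseteq> X" "cliques_le G S q"
    and "card X + 2 * j + s \<le> t" "q + j + s \<le> w" "0 < s"
  shows "\<exists>K. K \<subseteq> verts G \<and> card K = 2 * j \<and> K \<inter> X = {} \<and> cliques_le G K j \<and>
    (\<forall>u\<in>X. \<forall>v\<in>K. {u, v} \<in> edges G \<longleftrightarrow> u \<in> S) \<and> deficit K \<le> real j / real s \<and>
    (\<forall>Y\<subseteq>X \<union> K. card Y \<le> t \<longrightarrow> playable G t w d Y)"
  using assms(1,5,6)
proof (induction j arbitrary: d)
  case 0
  then have "playable G t w d X" by simp
  then show ?case using playable_subset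
    by (intro exI[of _ "{}"]) (auto simp: deficit_empty cliques_le_empty)
next
  case (Suc j)
  \<comment> \<open>A round costs \<open>s\<close> moves for \<open>V\<close> and one for
    \<open>v\<close>.\<close>
  have "playable G t w ((d + 1 + s) + j * (s + 1)) X" using Suc.prems(1) by (simp add: ac_simps)
  from Suc.IH[OF this] Suc.prems obtain K where K: "K \<subseteq> verts G" "card K = 2 * j"
    "K \<inter> X = {}" "cliques_le G K j" "\<forall>u\<in>X. \<forall>v\<in>K. {u, v} \<in> edges G \<longleftrightarrow> u \<in> S"
    "deficit K \<le> real j / real s"
    and play: "\<forall>Y\<subseteq>X \<union> K. card Y \<le> t \<longrightarrow> playable G t w (d + 1 + s) Y" by auto
  have fK: "finite K" using K(1) by (rule finite_subset_verts)
  have XV: "X \<subseteq> verts G" using Suc.prems(1) by (rule playable_verts)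
  have cXK: "card (X \<union> K) \<le> card X + 2 * j" using card_Un_le[of X K] K(2) by simp
  then have pXK: "playable G t w (d + 1 + s) (X \<union> K)" using play Suc.prems(2) by simp
  have cl: "cliques_le G (S \<union> K) (q + j)" by (rule cliques_le_Un[OF assms(4) K(4)])
  have SK: "S \<union> K \<subseteq> X \<union> K" using assms(3) by blast
  obtain V where V: "V \<subseteq> verts G" "finite V" "card V = s" "V \<inter> (X \<union> K) = {}" "clique G V"
    "\<forall>u\<in>X \<union> K. \<forall>v\<in>V. {u, v} \<in> edges G \<longleftrightarrow> u \<in> S \<union> K"
    and playV: "\<forall>Y\<subseteq>X \<union> K \<union> V. card Y \<le> t \<longrightarrow> playable G t w (d + 1) Y"
    using playable_add_clique[OF pXK _ SK cl] cXK Suc.prems(2,3) assms(2) fK by auto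
  have "card (X \<union> K \<union> V) \<le> t"
    using cXK card_Un_le[of "X \<union> K" V] V(3) Suc.prems(2) by simp
  then have "playable G t w (Suc d) (X \<union> K \<union> V)" using playV by simp
  moreover have "S \<union> K \<subseteq> X \<union> K \<union> V" using SK by blast
  moreover have "cliques_le G (S \<union> K) (w - 1)"
    using cliques_le_mono[OF cl] Suc.prems(3) by simp
  ultimately obtain v where v: "v \<in> verts G" "v \<notin> X \<union> K \<union> V"
    and adj: "\<And>u. u \<in> X \<union> K \<union> V \<Longrightarrow> {u, v} \<in> edges G \<longleftrightarrow> u \<in> S \<union> K"
    and move: "\<And>Y. Y \<subseteq> insert v (X \<union> K \<union> V) \<Longrightarrow> card Y \<le> t \<Longrightarrow> playable G t w d Y"
    by (rule playable_move) metis
  have "V \<noteq> {}" using V(3) assms(7) by auto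
  moreover have "clique G {v}" using v(1) by (simp add: clique_def)
  \<comment> \<open>Averaging with the one-vertex clique \<open>{v}\<close> against
    \<open>V\<close>, which has deficit zero, gives \<open>(1 + 0) / (1 * s)\<close>.\<close>
  ultimately obtain x where x: "x \<in> V" "measure lebesgue (\<phi> v \<inter> \<phi> x) \<le> 1 / real s"
    using exists_pair_small_overlap[OF V(1), of "{v}"] V(3) deficit_clique[OF V(5)] by auto
  have vx: "v \<noteq> x" "{v, x} \<notin> edges G" "x \<in> verts G"
    using v(2) x(1) adj[of x] V(1,4) assms(3) by (auto simp: insert_commute)
  have new: "\<And>u y. u \<in> X \<union> K \<Longrightarrow> y \<in> {v, x} \<Longrightarrow> {u, y} \<in> edges G \<longleftrightarrow> u \<in> S \<union> K"
    using adj V(6) x(1) by auto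
  let ?K = "K \<union> {v, x}"
  have disj: "K \<inter> {v, x} = {}" using v V(4) x(1) by auto
  show ?case
  proof (intro exI[of _ ?K] conjI)
    show "card ?K = 2 * Suc j" using disj K(2) fK vx(1) by (simp add: card_Un_disjoint)
    show "?K \<inter> X = {}" using K(3) v V(4) x(1) by auto
    have "cliques_le G {v, x} 1"
      by (rule cliques_le_independent) (use vx in \<open>auto simp: insert_commute\<close>)
    then show "cliques_le G ?K (Suc j)" using cliques_le_Un[OF K(4)] by fastforce
    show "\<forall>u\<in>X. \<forall>y\<in>?K. ({u, y} \<in> edges G) = (u \<in> S)"
      using K(3,5) new by blast
    have "deficit ?K = deficit K + deficit {v, x}"
      using new disj by (intro deficit_Un K(1)) (use v(1) vx in auto)
    then show "deficit ?K \<le> real (Suc j) / real s"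
      using x(2) K(6) deficit_pair[OF v(1) vx(3) vx(1)] by (simp add: add_divide_distrib)
    have "X \<union> ?K \<subseteq> insert v (X \<union> K \<union> V)" using x(1) by blast
    then show "\<forall>Y\<subseteq>X \<union> ?K. card Y \<le> t \<longrightarrow> playable G t w d Y"
      using move by (meson order_trans)
    show "?K \<subseteq> verts G" using K(1) v(1) vx(3) by blast
  qed
qed

text \<open>Three blocks joined to \<open>P\<close> are added: an \<open>r\<close>-clique
  \<open>L\<close>, then \<open>j\<close> crude pairs \<open>K\<close>, then an
  \<open>s\<close>-clique \<open>V\<close> joined to \<open>K\<close>; neither \<open>K\<close> nor
  \<open>V\<close> has edges to \<open>L\<close>. Since \<open>K \<union> V\<close> has
  \<open>2 * j + s\<close> vertices and deficit at most \<open>j / s\<close>, averaging against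
  \<open>L\<close> finds the new pair, and the deficit enters only as a relative error
  \<open>j / (r * s)\<close>.\<close>

lemma playable_add_pair:
  assumes "playable G t w (d + s + j * (s + 1) + r) P" "cliques_le G P i" "card P = 2 * i"
    and "2 * i + r + 2 * j + s \<le> t" "i + r \<le> w" "i + j + s \<le> w" "0 < r" "0 < s"
  shows "\<exists>P'. cliques_le G P' (Suc i) \<and> card P' = 2 * Suc i \<and> playable G t w d P' \<and>
    deficit P' \<le> deficit P + (real r + real j / real s) / (real r * real (2 * j + s))"
proof -
  have PV: "P \<subseteq> verts G" using assms(1) by (rule playable_verts)
  have fP: "finite P" using PV by (rule finite_subset_verts)
  obtain L where L: "L \<subseteq> verts G" "finite L" "card L = r" "L \<inter> P = {}" "clique G L"
    "\<forall>u\<in>P. \<forall>v\<in>L. {u, v} \<in> edges G \<longleftrightarrow> u \<in> P"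
    and playL: "\<forall>Y\<subseteq>P \<union> L. card Y \<le> t \<longrightarrow> playable G t w (d + s + j * (s + 1)) Y"
    using playable_add_clique[OF assms(1) fP subset_refl assms(2)] assms(3-5) by auto
  have cPL: "card (P \<union> L) = 2 * i + r"
    using L(3,4) assms(3) fP L(2) by (simp add: card_Un_disjoint Int_commute)
  have pPL: "playable G t w (d + s + j * (s + 1)) (P \<union> L)" using playL cPL assms(4) by simp
  have fPL: "finite (P \<union> L)" using fP L(2) by simp
  obtain K where K: "K \<subseteq> verts G" "card K = 2 * j" "K \<inter> (P \<union> L) = {}" "cliques_le G K j"
    "\<forall>u\<in>P \<union> L. \<forall>v\<in>K. {u, v} \<in> edges G \<longleftrightarrow> u \<in> P" "deficit K \<le> real j / real s"
    and playK: "\<forall>Y\<subseteq>P \<union> L \<union> K. card Y \<le> t \<longrightarrow> playable G t w (d + s) Y"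
    using playable_low_deficit_pairs[OF pPL fPL Un_upper1 assms(2)] cPL assms(4,6,8) by auto
  have fK: "finite K" using K(1) by (rule finite_subset_verts)
  have cPLK: "card (P \<union> L \<union> K) = 2 * i + r + 2 * j"
    using cPL K(2,3) fPL fK by (simp add: card_Un_disjoint Int_commute)
  have pPLK: "playable G t w (d + s) (P \<union> L \<union> K)" using playK cPLK assms(4) by simp
  have sub: "P \<union> K \<subseteq> P \<union> L \<union> K" by blast
  obtain V where V: "V \<subseteq> verts G" "finite V" "card V = s" "V \<inter> (P \<union> L \<union> K) = {}" "clique G V"
    "\<forall>u\<in>P \<union> L \<union> K. \<forall>v\<in>V. {u, v} \<in> edges G \<longleftrightarrow> u \<in> P \<union> K"
    and playV: "\<forall>Y\<subseteq>P \<union> L \<union> K \<union> V. card Y \<le> t \<longrightarrow> playable G t w d Y"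
    using playable_add_clique[OF pPLK _ sub cliques_le_Un[OF assms(2) K(4)]] cPLK assms(4,6) fPL fK
    by auto
  let ?K = "K \<union> V"
  have cK: "card ?K = 2 * j + s" using K(2) V(2-4) fK by (subst card_Un_disjoint) auto
  have "deficit ?K = deficit K + deficit V"
    by (rule deficit_Un) (use K(1) V in auto)
  then have dK: "deficit ?K \<le> real j / real s" using deficit_clique[OF V(5)] K(6) by simp
  have "?K \<subseteq> verts G" "?K \<noteq> {}" "L \<noteq> {}" using K(1) V(1,3) L(3) assms(7,8) by auto
  then obtain v x where vx: "v \<in> L" "x \<in> ?K" "measure lebesgue (\<phi> v \<inter> \<phi> x)
      \<le> (real r + deficit ?K) / (real r * real (2 * j + s))"
    using exists_pair_small_overlap[of ?K L] L(3,5) cK by metis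
  have "(real r + deficit ?K) / (real r * real (2 * j + s))
      \<le> (real r + real j / real s) / (real r * real (2 * j + s))"
    using dK by (intro divide_right_mono) auto
  with vx(3) have ov: "measure lebesgue (\<phi> v \<inter> \<phi> x)
      \<le> (real r + real j / real s) / (real r * real (2 * j + s))" by (rule order_trans)
  have "v \<notin> P" "v \<notin> K" using vx(1) L(4) K(3) by auto
  have ne: "v \<noteq> x" "x \<notin> P" "v \<in> verts G" "x \<in> verts G"
    using vx(1,2) L K(1,3) V(1,4) by auto
  \<comment> \<open>The neighborhoods prescribed for \<open>K\<close> and \<open>V\<close> both
    avoid \<open>L\<close>.\<close>
  have nadj: "{v, x} \<notin> edges G"
  proof (cases "x \<in> K")
    case True
    then show ?thesis using K(5) vx(1) \<open>v \<notin> P\<close> by blast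
  next
    case False
    then have "x \<in> V" using vx(2) by blast
    then show ?thesis using V(6) vx(1) \<open>v \<notin> P\<close> \<open>v \<notin> K\<close> by blast
  qed
  have adj: "{u, y} \<in> edges G" if "u \<in> P" "y \<in> {v, x}" for u y
    using that vx(1,2) L(6) K(5) V(6) by blast
  let ?P = "P \<union> {v, x}"
  have disj: "P \<inter> {v, x} = {}" using \<open>v \<notin> P\<close> ne(2) by blast
  have "deficit ?P = deficit P + deficit {v, x}"
    using adj disj ne by (intro deficit_Un PV) auto
  then have "deficit ?P \<le> deficit P + (real r + real j / real s) / (real r * real (2 * j + s))"
    using ov deficit_pair ne by simp
  moreover have "cliques_le G {v, x} 1"
    by (rule cliques_le_independent) (use nadj in \<open>auto simp: insert_commute\<close>)
  then have "cliques_le G ?P (Suc i)" using cliques_le_Un[OF assms(2)] by fastforce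
  moreover have cP: "card ?P = 2 * Suc i"
    using disj assms(3) fP ne(1) by (simp add: card_Un_disjoint)
  moreover have "playable G t w d ?P"
  proof -
    have "?P \<subseteq> P \<union> L \<union> K \<union> V" using vx(1,2) by blast
    moreover have "card ?P \<le> t" using cP assms(4,7,8) by simp
    ultimately show ?thesis using playV by blast
  qed
  ultimately show ?thesis by blast
qed

text \<open>With \<open>k\<close> pairs found, \<open>p - 1 - k\<close> crude pairs are used, so
  their numbers always add up to \<open>p - 1\<close> and the same bounds on vertices and cliques
  serve every round. The set averaged over shrinks by two vertices per round.\<close>

lemma playable_many_pairs:
  assumes "playable G t w (d + i * (r + p * (s + 1) + s)) {}" "i \<le> p"
    and "2 * p + r + s \<le> t + 2" "p + r \<le> w + 1" "p + s \<le> w + 1" "0 < r" "0 < s"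
  shows "\<exists>P. cliques_le G P i \<and> card P = 2 * i \<and> playable G t w d P \<and>
    deficit P \<le> (\<Sum>k<i. (real r + real p / real s) / (real r * real (2 * (p - 1 - k) + s)))"
  using assms(1,2)
proof (induction i arbitrary: d)
  case 0
  then have "playable G t w d {}" by simp
  then show ?case by (intro exI[of _ "{}"] conjI) (simp_all add: deficit_empty cliques_le_empty)
next
  case (Suc i)
  let ?L = "r + p * (s + 1) + s" and ?j = "p - 1 - i"
  have "playable G t w ((d + ?L) + i * ?L) {}"
    using Suc.prems(1) by (simp only: mult_Suc add.assoc)
  from Suc.IH[OF this] Suc.prems(2) obtain P where P: "cliques_le G P i" "card P = 2 * i"
    "playable G t w (d + ?L) P"
    "deficit P \<le> (\<Sum>k<i. (real r + real p / real s) / (real r * real (2 * (p - 1 - k) + s)))"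
    by auto
  have j: "i + ?j = p - 1" "?j \<le> p" using Suc.prems(2) by auto
  \<comment> \<open>Rounds need different numbers of moves; bounding the crude pairs by
    \<open>p\<close> gives one budget for all.\<close>
  have "?j * (s + 1) \<le> p * (s + 1)" using j(2) by (rule mult_le_mono1)
  then have le: "d + s + ?j * (s + 1) + r \<le> d + ?L" by linarith
  have c: "2 * i + r + 2 * ?j + s \<le> t" "i + r \<le> w" "i + ?j + s \<le> w"
    using j assms(3-5) Suc.prems(2) by linarith+
  obtain P' where P': "cliques_le G P' (Suc i)" "card P' = 2 * Suc i" "playable G t w d P'"
    "deficit P' \<le> deficit P + (real r + real ?j / real s) / (real r * real (2 * ?j + s))"
    using playable_add_pair[OF playable_mono[OF P(3) le] P(1,2) c assms(6,7)] by blast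
  have "(real r + real ?j / real s) / (real r * real (2 * ?j + s))
      \<le> (real r + real p / real s) / (real r * real (2 * ?j + s))"
    using j(2) by (intro divide_right_mono add_left_mono) auto
  then show ?case using P' P(4) by (intro exI[of _ P']) simp
qed

text \<open>The \<open>p\<close> pairs are completed to \<open>t + 1\<close> vertices by a clique
  joined to all of them, which adds nothing to the deficit.\<close>

lemma playable_measure_ge:
  assumes "playable G t w (t + 1 - 2 * p + p * (r + p * (s + 1) + s)) {}"
    and "2 * p \<le> t" "t + 1 \<le> w + p"
    and "2 * p + r + s \<le> t + 2" "p + r \<le> w + 1" "p + s \<le> w + 1" "0 < r" "0 < s"
  shows "real t + 1 - (\<Sum>k<p. (real r + real p / real s) / (real r * real (2 * (p - 1 - k) + s)))
    \<le> measure lebesgue (\<Union>v\<in>verts G. \<phi> v)"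
proof -
  obtain P where P: "cliques_le G P p" "card P = 2 * p" "playable G t w (t + 1 - 2 * p) P"
    "deficit P \<le> (\<Sum>k<p. (real r + real p / real s) / (real r * real (2 * (p - 1 - k) + s)))"
    using playable_many_pairs[OF assms(1) order_refl assms(4-8)] by blast
  have PV: "P \<subseteq> verts G" using P(3) by (rule playable_verts)
  have fP: "finite P" using PV by (rule finite_subset_verts)
  have play: "playable G t w (0 + (t + 1 - 2 * p)) P" using P(3) by simp
  \<comment> \<open>A clique takes at most one vertex from each pair, so the final set has cliques
    of at most \<open>t + 1 - p\<close> vertices; this ties \<open>p\<close> to
    \<open>w\<close>.\<close>
  have le: "p + (t + 1 - 2 * p) \<le> w" using assms(2,3) by linarith
  obtain V where V: "V \<subseteq> verts G" "finite V" "card V = t + 1 - 2 * p" "V \<inter> P = {}" "clique G V"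
    "\<forall>u\<in>P. \<forall>v\<in>V. {u, v} \<in> edges G \<longleftrightarrow> u \<in> P"
    using playable_add_clique[OF play fP subset_refl P(1) _ le] P(2) assms(2) by auto
  have "deficit (P \<union> V) = deficit P + deficit V"
    using V by (intro deficit_Un PV) auto
  then have "deficit (P \<union> V) = deficit P" using deficit_clique[OF V(5)] by simp
  moreover have "card (P \<union> V) = t + 1"
    using V fP P(2) assms(2) by (simp add: card_Un_disjoint Int_commute)
  moreover have "measure lebesgue (\<Union>v\<in>P \<union> V. \<phi> v) \<le> measure lebesgue (\<Union>v\<in>verts G. \<phi> v)"
  proof (rule measure_mono_fmeasurable)
    show "(\<Union>v\<in>P \<union> V. \<phi> v) \<subseteq> (\<Union>v\<in>verts G. \<phi> v)" using PV V(1) by blast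
    show "(\<Union>v\<in>P \<union> V. \<phi> v) \<in> sets lebesgue"
      using union_lmeasurable[of "P \<union> V"] PV V(1) by (auto dest: fmeasurableD)
    show "(\<Union>v\<in>verts G. \<phi> v) \<in> lmeasurable" by (rule union_lmeasurable) simp
  qed
  ultimately show ?thesis using P(4) unfolding deficit_def by simp
qed

end

text \<open>One graph must withstand all colorings: the universal extension is fixed first, and the
  moves inside it are chosen only once a coloring is given.\<close>

lemma exists_graph_large_fractional_chromatic_number:
  assumes "2 \<le> w" "w \<le> t" "2 * p \<le> t" "t + 1 = w + p"
    and "2 * p + r + s \<le> t + 2" "p + r \<le> w + 1" "p + s \<le> w + 1" "0 < r" "0 < s"
  shows "\<exists>G. simple_graph G \<and> treewidth G = t \<and> clique_number G = w \<and>
    real t + 1 - (\<Sum>k<p. (real r + real p / real s) / (real r * real (2 * (p - 1 - k) + s)))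
      \<le> fractional_chromatic_number G"
proof -
  \<comment> \<open>The moves of \<open>p\<close> rounds of the pair search, followed by
    \<open>t + 1 - 2 * p\<close> moves for the final clique.\<close>
  let ?D = "t + 1 - 2 * p + p * (r + p * (s + 1) + s)"
  obtain G0 H0 A B where 0: "hosted t w G0 H0" "clique H0 A" "card A = t" "B \<subseteq> verts G0"
    "card B = t" "A \<inter> B = {}" "\<forall>a\<in>A. \<forall>b\<in>B. {a, b} \<in> edges G0"
    using exists_hosted_complete_bipartite[OF assms(1), of t t] by blast
  have "0 < w" using assms(1) by simp
  \<comment> \<open>The budget covers two separate games from the empty set: \<open>w\<close> moves
    build a clique showing that the clique number reaches \<open>w\<close>, and \<open>?D\<close>
    moves are played against a coloring.\<close>
  obtain G H where G: "hosted t w G H" "induced_subgraph G0 G"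
    and "\<forall>N X. clique H0 N \<and> card N = t \<and> X \<subseteq> N \<longrightarrow> playable G t w (w + ?D) X"
    using exists_playable_extension[OF 0(1) \<open>0 < w\<close>, of "w + ?D"] by (elim exE conjE) (rule that)
  then have play: "playable G t w (w + ?D) {}" using 0(2,3) by blast
  have sG: "simple_graph G" "cliques_le G (verts G) w" using G(1) by (auto simp: hosted_def)
  have A0: "A \<subseteq> verts G0" using 0(1,2) by (auto simp: hosted_def clique_def)
  have "A \<subseteq> verts G" "B \<subseteq> verts G" "\<forall>a\<in>A. \<forall>b\<in>B. {a, b} \<in> edges G"
    using A0 0(4,7) G(2) unfolding induced_subgraph_def by blast+
  then have tw: "treewidth G = t"
    using treewidth_hosted[OF G(1)] 0(3,5,6) by blast
  have "playable G t w (0 + w) {}" using playable_mono[OF play] by simp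
  from playable_add_clique[OF this _ subset_refl cliques_le_empty]
  obtain K where "card K = w" "clique G K" using assms(2) by auto
  then have cn: "clique_number G = w" by (rule clique_number_eqI[OF sG, rotated])
  have play': "playable G t w ?D {}" using playable_mono[OF play] by simp
  have "t + 1 \<le> w + p" using assms(4) by simp
  then have "real t + 1 - (\<Sum>k<p. (real r + real p / real s) / (real r * real (2 * (p - 1 - k) + s)))
      \<le> measure lebesgue (\<Union>v\<in>verts G. \<phi> v)" if "fractional_coloring G \<phi>" for \<phi>
    by (rule colored_graph.playable_measure_ge[OF colored_graph.intro[OF sG(1) that] play' assms(3) _ assms(5-9)])
  from fractional_chromatic_number_geI[OF sG(1) this]
  have "real t + 1 - (\<Sum>k<p. (real r + real p / real s) / (real r * real (2 * (p - 1 - k) + s)))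
      \<le> fractional_chromatic_number G" .
  then show ?thesis using sG tw cn by blast
qed

section \<open>Estimating the total overlap\<close>

text \<open>This is \<open>ln y \<le> y - 1\<close> at \<open>y = (x - 2) / x\<close>. The shift by
  2 is the gap between successive denominators, so that the sum of these bounds telescopes.\<close>

lemma inverse_le_ln_diff:
  fixes x :: real
  assumes "2 < x"
  shows "1 / x \<le> (ln x - ln (x - 2)) / 2"
proof -
  have "ln ((x - 2) / x) \<le> (x - 2) / x - 1" using assms by (intro ln_le_minus_one) simp
  also have "(x - 2) / x - 1 = - 2 / x" using assms by (simp add: field_simps)
  finally have "2 / x \<le> ln x - ln (x - 2)" using assms by (simp add: ln_div)
  then show ?thesis by simp
qed

lemma sum_inverse_le_ln_diff:
  fixes s :: real
  assumes "2 < s"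
  shows "(\<Sum>k<p. 1 / (2 * real k + s)) \<le> (ln (2 * real p + s - 2) - ln (s - 2)) / 2"
proof (induction p)
  case (Suc p)
  have "1 / (2 * real p + s) \<le> (ln (2 * real p + s) - ln (2 * real p + s - 2)) / 2"
    using assms by (intro inverse_le_ln_diff) simp
  then show ?case using Suc by (simp add: algebra_simps diff_divide_distrib)
qed simp

text \<open>Here \<open>x\<close> stands for \<open>t\<close>, and the constants 2 and 4 absorb the
  rounding in \<open>p\<close> and \<open>s\<close>. After reversing the order, each summand is
  \<open>(1 + p / (r * s)) / (2 * k + s)\<close>: the numerator is the relative error of the
  averaging, and the remaining sum is at most half the logarithm of a ratio.\<close>

lemma pair_overlap_sum_le:
  assumes "2 < s" "0 < r" "real p \<le> c * x + 2" "(1 - 2 * c) * x - 2 - r \<le> real s"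
    "4 + real r < (1 - 2 * c) * x" "2 * real p + real s - 2 \<le> x" "0 < c" "0 < x"
  shows "(\<Sum>k<p. (real r + real p / real s) / (real r * real (2 * (p - 1 - k) + s)))
    \<le> (1 + (c * x + 2) / (r * ((1 - 2 * c) * x - 2 - r))) * ((ln x - ln ((1 - 2 * c) * x - 4 - r)) / 2)"
proof -
  let ?f = "\<lambda>k. (real r + real p / real s) / (real r * real (2 * k + s))"
  have "(\<Sum>k<p. ?f (p - 1 - k)) = (\<Sum>k<p. ?f k)"
    using sum.nat_diff_reindex[of ?f p] by simp
  also have "\<dots> = (\<Sum>k<p. (1 + real p / (real r * real s)) * (1 / (2 * real k + real s)))"
    using assms(1,2) by (intro sum.cong refl) (simp add: field_simps)
  also have "\<dots> = (1 + real p / (real r * real s)) * (\<Sum>k<p. 1 / (2 * real k + real s))"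
    by (simp add: sum_distrib_left)
  also have "\<dots> \<le> (1 + (c * x + 2) / (r * ((1 - 2 * c) * x - 2 - r))) *
      ((ln x - ln ((1 - 2 * c) * x - 4 - r)) / 2)"
  proof (rule mult_mono)
    have "real p / (real r * real s) \<le> (c * x + 2) / (r * ((1 - 2 * c) * x - 2 - r))"
      using assms by (intro frac_le mult_mono mult_pos_pos) auto
    then show "1 + real p / (real r * real s) \<le> 1 + (c * x + 2) / (r * ((1 - 2 * c) * x - 2 - r))"
      by simp
    have "ln (2 * real p + s - 2) \<le> ln x" using assms by (subst ln_le_cancel_iff) auto
    moreover have "ln ((1 - 2 * c) * x - 4 - r) \<le> ln (real s - 2)"
      using assms by (subst ln_le_cancel_iff) auto
    ultimately have "(ln (2 * real p + s - 2) - ln (real s - 2)) / 2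
        \<le> (ln x - ln ((1 - 2 * c) * x - 4 - r)) / 2"
      by (intro divide_right_mono diff_mono) auto
    moreover have "(\<Sum>k<p. 1 / (2 * real k + real s)) \<le> (ln (2 * real p + s - 2) - ln (real s - 2)) / 2"
      using assms(1) by (intro sum_inverse_le_ln_diff) simp
    ultimately show "(\<Sum>k<p. 1 / (2 * real k + real s)) \<le> (ln x - ln ((1 - 2 * c) * x - 4 - r)) / 2"
      by (rule order_trans[rotated])
    show "0 \<le> (\<Sum>k<p. 1 / (2 * real k + real s))" by (intro sum_nonneg) auto
    have "0 \<le> (c * x + 2) / (r * ((1 - 2 * c) * x - 2 - r))"
      using assms by (intro divide_nonneg_nonneg mult_nonneg_nonneg) auto
    then show "0 \<le> 1 + (c * x + 2) / (r * ((1 - 2 * c) * x - 2 - r))" by simp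
  qed
  finally show ?thesis .
qed

text \<open>With \<open>a\<close> in the role of \<open>1 - 2 * c\<close>, the bound for fixed
  \<open>r\<close> tends to \<open>(1 + c / (r * a)) * (- ln a / 2)\<close>. Hence \<open>r\<close>
  is fixed first as a constant, and only then does \<open>x\<close> grow.\<close>

lemma exists_overlap_bound:
  fixes a c \<epsilon> :: real
  assumes a: "0 < a" "a < 1" and c: "0 < c" and \<epsilon>: "0 < \<epsilon>"
  obtains r :: nat where "0 < r"
    "eventually (\<lambda>x::real. (1 + (c * x + 2) / (r * (a * x - 2 - r))) *
      ((ln x - ln (a * x - 4 - r)) / 2) < - ln a / 2 + \<epsilon> \<and> 2 * real r + 10 < a * x) at_top"
proof -
  \<comment> \<open>This makes the excess \<open>c * (- ln a) / (2 * a * r)\<close> of the limit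
    over \<open>- ln a / 2\<close> smaller than \<open>\<epsilon>\<close>.\<close>
  obtain r :: nat where r: "c * (- ln a) / (2 * a * \<epsilon>) < real r" using reals_Archimedean2 by blast
  have "0 < c * (- ln a) / (2 * a * \<epsilon>)"
    using assms by (intro divide_pos_pos mult_pos_pos) auto
  then have r0: "0 < real r" using r by linarith
  have "c * (- ln a) < real r * (2 * a * \<epsilon>)"
    using r a \<epsilon> by (subst (asm) pos_divide_less_eq) auto
  then have "c * (- ln a) / (2 * a * real r) < \<epsilon>"
    using a r0 by (subst pos_divide_less_eq) (auto simp: mult_ac)
  moreover have "(1 + c / (r * a)) * (- ln a / 2) = - ln a / 2 + c * (- ln a) / (2 * a * real r)"
    using a r0 by (simp add: field_simps)
  ultimately have lim: "(1 + c / (r * a)) * (- ln a / 2) < - ln a / 2 + \<epsilon>"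
    by linarith
  have "((\<lambda>x::real. (1 + (c * x + 2) / (r * (a * x - 2 - r))) * ((ln x - ln (a * x - 4 - r)) / 2))
      \<longlongrightarrow> - ((1 + c * (inverse (real r) * inverse a)) * ln a / 2)) at_top"
    using a c r0 by real_asymp
  moreover have "- ((1 + c * (inverse (real r) * inverse a)) * ln a / 2) = (1 + c / (r * a)) * (- ln a / 2)"
    using a r0 by (simp add: field_simps)
  ultimately have "((\<lambda>x::real. (1 + (c * x + 2) / (r * (a * x - 2 - r))) * ((ln x - ln (a * x - 4 - r)) / 2))
      \<longlongrightarrow> (1 + c / (r * a)) * (- ln a / 2)) at_top"
    by (simp only:)
  from order_tendstoD(2)[OF this lim]
  have "eventually (\<lambda>x::real. (1 + (c * x + 2) / (r * (a * x - 2 - r))) *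
      ((ln x - ln (a * x - 4 - r)) / 2) < - ln a / 2 + \<epsilon>) at_top" .
  moreover have "eventually (\<lambda>x::real. 2 * real r + 10 < a * x) at_top"
    using a by real_asymp
  ultimately have "eventually (\<lambda>x::real. (1 + (c * x + 2) / (r * (a * x - 2 - r))) *
      ((ln x - ln (a * x - 4 - r)) / 2) < - ln a / 2 + \<epsilon> \<and> 2 * real r + 10 < a * x) at_top"
    by (rule eventually_conj)
  moreover have "0 < r" using r0 by simp
  ultimately show ?thesis by (rule that[rotated])
qed

section \<open>Choice of the parameters\<close>

theorem theorem1p2:
  fixes c :: real
  assumes "0 < c" and "c < 1 / 2"
  shows "\<forall>\<epsilon>>0. \<exists>t0::nat. \<forall>t\<ge>t0. \<exists>G.
           simple_graph G \<and> treewidth G = t \<and>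
           int (clique_number G) = \<lfloor>(1 - c) * real t\<rfloor> \<and>
           fractional_chromatic_number G \<ge> real t + 1 + 1 / 2 * ln (1 - 2 * c) - \<epsilon>"
proof (intro allI impI)
  fix \<epsilon> :: real
  assume "0 < \<epsilon>"
  define a where "a = 1 - 2 * c"
  have a: "0 < a" "a < 1" using assms by (auto simp: a_def)
  obtain r :: nat where r0: "0 < r" and
    "eventually (\<lambda>x::real. (1 + (c * x + 2) / (r * (a * x - 2 - r))) *
      ((ln x - ln (a * x - 4 - r)) / 2) < - ln a / 2 + \<epsilon> \<and> 2 * real r + 10 < a * x) at_top"
    using exists_overlap_bound[OF a assms(1) \<open>0 < \<epsilon>\<close>] .
  then obtain x0 where x0: "\<And>x. x0 \<le> x \<Longrightarrow> (1 + (c * x + 2) / (r * (a * x - 2 - r))) *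
      ((ln x - ln (a * x - 4 - r)) / 2) < - ln a / 2 + \<epsilon> \<and> 2 * real r + 10 < a * x"
    unfolding eventually_at_top_linorder by blast
  show "\<exists>t0::nat. \<forall>t\<ge>t0. \<exists>G. simple_graph G \<and> treewidth G = t \<and>
           int (clique_number G) = \<lfloor>(1 - c) * real t\<rfloor> \<and>
           fractional_chromatic_number G \<ge> real t + 1 + 1 / 2 * ln (1 - 2 * c) - \<epsilon>"
  proof (rule exI[of _ "nat \<lceil>x0\<rceil>"], intro allI impI)
    fix t :: nat
    assume "nat \<lceil>x0\<rceil> \<le> t"
    then have "x0 \<le> real t" by linarith
    then have t: "(1 + (c * t + 2) / (r * (a * t - 2 - r))) *
      ((ln t - ln (a * t - 4 - r)) / 2) < - ln a / 2 + \<epsilon>" "2 * real r + 10 < a * t"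
      using x0 by blast+
    have "0 < t" using t(2) by (intro Nat.gr0I) simp
    define w where "w = nat \<lfloor>(1 - c) * real t\<rfloor>"
    \<comment> \<open>With this \<open>p\<close> the final set of \<open>t + 1\<close> vertices has
      cliques of at most \<open>w\<close> vertices; \<open>s\<close> then takes all the room left by
      \<open>2 * p + r + s \<le> t + 2\<close>. Both natural subtractions turn out to be
      exact.\<close>
    define p where "p = t + 1 - w"
    define s where "s = t + 2 - 2 * p - r"
    have fl: "int w = \<lfloor>(1 - c) * real t\<rfloor>" using assms by (simp add: w_def)
    then have "real w \<le> (1 - c) * real t" "(1 - c) * real t < real w + 1"
      by (metis of_int_floor_le of_int_of_nat_eq, metis real_of_int_floor_add_one_gt of_int_of_nat_eq)
    then have w: "real w \<le> real t - c * t" "real t - c * t < real w + 1" by (simp_all add: algebra_simps)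
    have ct: "0 < c * t" using assms(1) \<open>0 < t\<close> by simp
    have at: "a * t = real t - 2 * (c * t)" by (simp add: a_def algebra_simps)
    have "real w < real t" using w ct by linarith
    then have wt: "w < t" by simp
    then have p: "t + 1 = w + p" "real p = real t + 1 - real w" by (simp_all add: p_def)
    \<comment> \<open>Since \<open>p < c * t + 2\<close>, the slack
      \<open>a * t = t - 2 * (c * t)\<close>, which exceeds \<open>2 * r + 10\<close>, absorbs the
      rounding and \<open>r\<close>.\<close>
    have "2 * real p + real r \<le> real t" using p(2) w t(2) at by linarith
    then have "real (2 * p + r) \<le> real t" by simp
    then have p2: "2 * p + r \<le> t" by (simp only: of_nat_le_iff)
    then have s: "real s = real t + 2 - 2 * real p - r" "2 * p + r + s = t + 2" by (simp_all add: s_def)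
    have "real (p + r) \<le> real (w + 1)" using p(2) w t(2) at by simp
    then have pr: "p + r \<le> w + 1" by (simp only: of_nat_le_iff)
    have s2: "2 < s"
    proof -
      have "2 < real s" using s(1) p(2) w t(2) at by linarith
      then show ?thesis by simp
    qed
    have w2: "2 \<le> w"
    proof -
      have "2 \<le> real w" using w t(2) at ct by linarith
      then show ?thesis by simp
    qed
    \<comment> \<open>The equations for \<open>p\<close> and \<open>s\<close> combine to
      \<open>p + s + r = w + 1\<close>.\<close>
    have ps: "p + s \<le> w + 1" using s(2) p(1) r0 by linarith
    have "2 * p \<le> t" "w \<le> t" "0 < s" using p2 wt s2 by auto
    then obtain G where G: "simple_graph G" "treewidth G = t" "clique_number G = w"
      "real t + 1 - (\<Sum>k<p. (real r + real p / real s) / (real r * real (2 * (p - 1 - k) + s)))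
        \<le> fractional_chromatic_number G"
      using exists_graph_large_fractional_chromatic_number[OF w2 _ _ p(1) _ pr ps r0] s(2) by auto
    have "(\<Sum>k<p. (real r + real p / real s) / (real r * real (2 * (p - 1 - k) + s)))
      \<le> (1 + (c * t + 2) / (r * ((1 - 2 * c) * t - 2 - r))) * ((ln t - ln ((1 - 2 * c) * t - 4 - r)) / 2)"
    proof (rule pair_overlap_sum_le[OF s2 r0])
      show "real p \<le> c * real t + 2" using p(2) w by linarith
      then show "(1 - 2 * c) * real t - 2 - real r \<le> real s"
        using s(1) at unfolding a_def by linarith
      show "4 + real r < (1 - 2 * c) * real t" using t(2) unfolding a_def by linarith
      show "2 * real p + real s - 2 \<le> real t" using s(1) by linarith
    qed (use assms(1) \<open>0 < t\<close> in simp_all)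
    then have "real t + 1 + 1 / 2 * ln (1 - 2 * c) - \<epsilon> \<le> fractional_chromatic_number G"
      using G(4) t(1) unfolding a_def by linarith
    then show "\<exists>G. simple_graph G \<and> treewidth G = t \<and>
           int (clique_number G) = \<lfloor>(1 - c) * real t\<rfloor> \<and>
           fractional_chromatic_number G \<ge> real t + 1 + 1 / 2 * ln (1 - 2 * c) - \<epsilon>"
      using G(1-3) fl by blast
  qed
qed

end
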